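(* If there exists a rapid ultrafilter $p$ on $\mathbb{N}$, then there exist rapid idempotent ultrafilters on $\mathbb{N}$. More precisely, if $p$ is a rapid ultrafilter on $\mathbb{N}$, then every element of $\beta\mathbb{N}+p=\{q+p : q\in\beta\mathbb{N}\}$ is a rapid ultrafilter; in particular, $\beta\mathbb{N}+p$ contains minimal idempotents (of the semigroup $(\beta\mathbb{N},+)$) which are rapid.
   Context: $\mathbb{N}=\{1,2,3,\dots\}$ is the set of positive integers, and $\beta\mathbb{N}$ is the set of all ultrafilters on $\mathbb{N}$ (principal ones included), with its usual topology as the Stone–Čech compactification of discrete $\mathbb{N}$. Rapid: an ultrafilter $p$ on $\mathbb{N}$ is rapid if for every function $f:\mathbb{N}\to\mathbb{N}$ there exists $A\in p$ such that $|A\cap f(i)|<i$ for all $i\in\mathbb{N}$, where the natural number $f(i)$ is identified with the set of its predecessors, so that $A\cap f(i)=\{a\in A: a<f(i)\}$. Tensor product and sum: for $q,p\in\beta\mathbb{N}$, $q\otimes p$ is the ultrafilter on $\mathbb{N}\times\mathbb{N}$ generated by the sets $\bigcup_{v\in V}\{v\}\times W_v$ with $V\in q$ and $W_v\in p$ for each $v\in V$. The sum $q+p$ is the image of $q\otimes p$ under the addition map $+:\mathbb{N}\times\mathbb{N}\to\mathbb{N}$; equivalently, $A\in q+p$ if and only if $\{v\in\mathbb{N}: \{w\in\mathbb{N}: v+w\in A\}\in p\}\in q$. With this operation $\beta\mathbb{N}$ is a semigroup. Idempotents: $e\in\beta\mathbb{N}$ is idempotent if $e+e=e$. An idempotent $e$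 is minimal if it is minimal among the idempotents of $\beta\mathbb{N}$ with respect to the order $e\le e' \Leftrightarrow e+e'=e'+e=e$; equivalently, $e$ belongs to a minimal left ideal of $(\beta\mathbb{N},+)$ (a left ideal being a nonempty $L\subseteq\beta\mathbb{N}$ with $\beta\mathbb{N}+L\subseteq L$). *)

theory Defs
  imports Complex_Main "HOL-Library.FuncSet"
begin

text \<open>
  The positive integers are the subset \<open>{1..}\<close> of \<open>nat\<close>; a filter on them is a \<open>nat filter\<close>
  that contains this set. The filter order of the library is reversed inclusion, so
  \<open>F \<le> principal X\<close> says that \<open>X\<close> belongs to \<open>F\<close>.
\<close>

abbreviation posnat :: "nat set" where
  "posnat \<equiv> {1..}"

definition ultrafilter_on :: "'a set \<Rightarrow> 'a filter \<Rightarrow> bool" where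
  "ultrafilter_on X F \<longleftrightarrow> F \<noteq> bot \<and> F \<le> principal X \<and>
     (\<forall>A\<subseteq>X. eventually (\<lambda>x. x \<in> A) F \<or> eventually (\<lambda>x. x \<in> X - A) F)"

definition beta_N :: "nat filter set" where
  "beta_N = {p. ultrafilter_on posnat p}"

definition members :: "nat filter \<Rightarrow> nat set set" where
  "members p = {A. A \<subseteq> posnat \<and> eventually (\<lambda>n. n \<in> A) p}"

definition rapid :: "nat filter \<Rightarrow> bool" where
  "rapid p \<longleftrightarrow> p \<in> beta_N \<and>
     (\<forall>f \<in> posnat \<rightarrow> posnat. \<exists>A\<in>members p. \<forall>i\<in>posnat. card {a \<in> A. a < f i} < i)"

text \<open>The infimum of principal filters is the filter generated by the given sets.\<close>

definition tensor :: "nat filter \<Rightarrow> nat filter \<Rightarrow> (nat \<times> nat) filter" where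
  "tensor q p =
     (INF B \<in> {Sigma V W | V W. V \<in> members q \<and> (\<forall>v\<in>V. W v \<in> members p)}. principal B)"

definition usum :: "nat filter \<Rightarrow> nat filter \<Rightarrow> nat filter" (infixl "\<oplus>" 65) where
  "q \<oplus> p = filtermap (\<lambda>(v, w). v + w) (tensor q p)"

definition idempotent :: "nat filter \<Rightarrow> bool" where
  "idempotent e \<longleftrightarrow> e \<in> beta_N \<and> e \<oplus> e = e"

definition idem_le :: "nat filter \<Rightarrow> nat filter \<Rightarrow> bool" where
  "idem_le e e' \<longleftrightarrow> e \<oplus> e' = e \<and> e' \<oplus> e = e"

definition minimal_idempotent :: "nat filter \<Rightarrow> bool" where
  "minimal_idempotent e \<longleftrightarrow> idempotent e \<and> (\<forall>e'. idempotent e' \<and> idem_le e' e \<longrightarrow> e' = e)"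

definition beta_N_plus :: "nat filter \<Rightarrow> nat filter set" where
  "beta_N_plus p = {q \<oplus> p | q. q \<in> beta_N}"

lemma eventually_members:
  assumes "p \<in> beta_N"
  shows "eventually P p \<longleftrightarrow> {n \<in> posnat. P n} \<in> members p"
proof -
  have "eventually (\<lambda>n. n \<in> posnat) p"
    using assms by (auto simp: beta_N_def ultrafilter_on_def le_principal)
  then show ?thesis
    unfolding members_def by (simp add: eventually_conj_iff subset_iff)
qed

lemma eventually_tensor:
  assumes q: "q \<in> beta_N" and p: "p \<in> beta_N"
  shows "eventually P (tensor q p) \<longleftrightarrow>
    eventually (\<lambda>v. eventually (\<lambda>w. P (v, w)) p) q"
proof -
  let ?B = "{Sigma V W | V W. V \<in> members q \<and> (\<forall>v\<in>V. W v \<in> members p)}"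
  have top: "posnat \<in> members r" if "r \<in> beta_N" for r
    using eventually_members[OF that, of "\<lambda>_. True"] by (simp add: atLeast_def)
  have Int: "A \<inter> B \<in> members r" if "A \<in> members r" "B \<in> members r" for A B r
    using that unfolding members_def by (simp add: eventually_conj_iff le_infI1)
  have "posnat \<times> posnat \<in> ?B"
    using top[OF q] top[OF p] by blast
  then have ne: "?B \<noteq> {}" by blast
  have dir: "\<exists>x\<in>?B. principal x \<le> inf (principal a) (principal b)"
    if "a \<in> ?B" "b \<in> ?B" for a b
  proof -
    obtain V W where a: "a = Sigma V W" "V \<in> members q" "\<forall>v\<in>V. W v \<in> members p"
      using \<open>a \<in> ?B\<close> by blast
    obtain V' W' where b: "b = Sigma V' W'" "V' \<in> members q" "\<forall>v\<in>V'. W' v \<in> members p"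
      using \<open>b \<in> ?B\<close> by blast
    have "Sigma (V \<inter> V') (\<lambda>v. W v \<inter> W' v) \<in> ?B"
    proof -
      have "\<forall>v\<in>V \<inter> V'. W v \<inter> W' v \<in> members p"
        using Int a(3) b(3) by simp
      then show ?thesis using Int[OF a(2) b(2)] by blast
    qed
    moreover have "principal (Sigma (V \<inter> V') (\<lambda>v. W v \<inter> W' v)) \<le> inf (principal a) (principal b)"
      unfolding a b by auto
    ultimately show ?thesis by blast
  qed
  have "eventually P (tensor q p) \<longleftrightarrow> (\<exists>B\<in>?B. \<forall>x\<in>B. P x)"
    unfolding tensor_def
    by (subst eventually_INF_base[OF ne dir]) (assumption+, simp only: eventually_principal)
  also have "\<dots> \<longleftrightarrow> eventually (\<lambda>v. eventually (\<lambda>w. P (v, w)) p) q"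
  proof
    assume "\<exists>B\<in>?B. \<forall>x\<in>B. P x"
    then obtain V W where V: "V \<in> members q" and W: "\<forall>v\<in>V. W v \<in> members p"
      and P: "\<forall>x\<in>Sigma V W. P x" by blast
    have "eventually (\<lambda>w. P (v, w)) p" if "v \<in> V" for v
    proof -
      have "eventually (\<lambda>w. w \<in> W v) p" using W that by (simp add: members_def)
      then show ?thesis by (rule eventually_mono) (use P that in auto)
    qed
    moreover have "eventually (\<lambda>v. v \<in> V) q" using V by (simp add: members_def)
    ultimately show "eventually (\<lambda>v. eventually (\<lambda>w. P (v, w)) p) q"
      by (auto elim: eventually_mono)
  next
    assume *: "eventually (\<lambda>v. eventually (\<lambda>w. P (v, w)) p) q"
    define V where "V = {v \<in> posnat. eventually (\<lambda>w. P (v, w)) p}"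
    define W where "W v = {w \<in> posnat. P (v, w)}" for v
    have "V \<in> members q" using * eventually_members[OF q] by (simp add: V_def)
    moreover have "\<forall>v\<in>V. W v \<in> members p"
      using eventually_members[OF p] by (simp add: V_def W_def)
    ultimately have "Sigma V W \<in> ?B" by blast
    moreover have "\<forall>x\<in>Sigma V W. P x" by (auto simp: W_def)
    ultimately show "\<exists>B\<in>?B. \<forall>x\<in>B. P x" by blast
  qed
  finally show ?thesis .
qed

lemma eventually_usum:
  assumes "q \<in> beta_N" "p \<in> beta_N"
  shows "eventually P (q \<oplus> p) \<longleftrightarrow> eventually (\<lambda>v. eventually (\<lambda>w. P (v + w)) p) q"
  by (simp add: usum_def eventually_filtermap eventually_tensor[OF assms])

end

theory Submission
  imports Defs
begin

text \<open>
  Rapidity of \<open>q \<oplus> p\<close>: enlarge \<open>f\<close> to a monotone function \<open>g\<close> and take \<open>A \<in> p\<close> with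
  fewer than \<open>j\<close> elements below \<open>g (j\<^sup>2)\<close>. The set of all \<open>v + w\<close> with \<open>w \<in> A\<close> and
  \<open>w \<ge> g (v\<^sup>2)\<close> belongs to \<open>q \<oplus> p\<close>. If \<open>j\<close> is least with \<open>i \<le> j\<^sup>2\<close>, then below \<open>f i\<close> there
  are at most \<open>j - 1\<close> possible values of each of \<open>v\<close> and \<open>w\<close>, hence at most
  \<open>(j - 1)\<^sup>2 < i\<close> sums.

  Minimal idempotents: \<open>q \<mapsto> q \<oplus> x\<close> is continuous and \<open>beta_N\<close> is compact, so the closed left
  ideal \<open>beta_N_plus p\<close> contains a minimal closed left ideal, which by the Ellis lemma contains an
  idempotent. Closed sets are handled through filters: a set of ultrafilters is closed iff it
  contains every ultrafilter below its supremum.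
\<close>

subsection \<open>Ultrafilters on the positive integers\<close>

text \<open>A chain is directed downwards, so whatever holds eventually for \<open>Inf \<F>\<close>
  already does so for a single member; applied to \<open>False\<close>, this would make that member
  \<open>bot\<close>.\<close>

lemma filter_Inf_chain_ne_bot:
  assumes "\<F> \<noteq> {}" and chain: "\<And>F G. F \<in> \<F> \<Longrightarrow> G \<in> \<F> \<Longrightarrow> F \<le> G \<or> G \<le> F"
    and "\<And>F. F \<in> \<F> \<Longrightarrow> F \<noteq> bot"
  shows "Inf \<F> \<noteq> (bot :: 'a filter)"
proof -
  have "\<exists>x\<in>\<F>. x \<le> inf F G" if "F \<in> \<F>" "G \<in> \<F>" for F G
    using chain[OF that] that by (metis inf.absorb1 inf.absorb2 order_refl)
  then show ?thesis
    using eventually_Inf_base[of \<F> "\<lambda>_. False"] assms(1,3)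
    by (auto simp: trivial_limit_def)
qed

text \<open>Zorn's lemma for proper filters below \<open>F\<close>; the infimum bounds a chain.
  Minimal in the library order means maximal as a family of sets.\<close>

lemma exists_minimal_filter:
  assumes "F \<noteq> (bot :: 'a filter)"
  obtains p where "p \<noteq> bot" "p \<le> F" "\<And>q. q \<noteq> bot \<Longrightarrow> q \<le> p \<Longrightarrow> q = p"
proof -
  define S where "S = {q. q \<noteq> bot \<and> q \<le> F}"
  have "\<exists>m\<in>S. \<forall>a\<in>S. a \<le> m \<longrightarrow> a = m"
  proof (rule predicate_Zorn[where P = "\<lambda>a b :: 'a filter. b \<le> a" and A = S])
    show "partial_order_on S (relation_of (\<lambda>a b. b \<le> a) S)"
      by (rule partial_order_on_relation_ofI) auto
  next
    fix C assume C: "C \<in> Chains (relation_of (\<lambda>a b. b \<le> a) S)"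
    have CS: "C \<subseteq> S" and ch: "\<And>a b. a \<in> C \<Longrightarrow> b \<in> C \<Longrightarrow> a \<le> b \<or> b \<le> a"
      using C by (auto simp: Chains_def relation_of_def)
    show "\<exists>u\<in>S. \<forall>a\<in>C. u \<le> a"
    proof (cases "C = {}")
      case True
      then show ?thesis using assms S_def by auto
    next
      case False
      have "Inf C \<noteq> bot"
        by (rule filter_Inf_chain_ne_bot[OF False ch]) (use CS S_def in auto)
      moreover have "Inf C \<le> F"
        using False CS Inf_lower order_trans unfolding S_def by blast
      ultimately show ?thesis by (auto simp: S_def intro!: bexI[of _ "Inf C"] Inf_lower)
    qed
  qed
  then obtain m where "m \<in> S" "\<forall>a\<in>S. a \<le> m \<longrightarrow> a = m" by blast
  then show thesis by (intro that[of m]) (auto simp: S_def)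
qed

text \<open>A minimal proper filter decides every \<open>A\<close>: if its meet with
  \<open>principal A\<close> is proper, minimality puts \<open>A\<close> into the filter, and
  otherwise the complement is there. This is the form in which compactness of \<open>beta_N\<close>
  is used below.\<close>

lemma exists_beta_N:
  assumes "F \<noteq> bot" "F \<le> principal posnat"
  obtains p where "p \<in> beta_N" "p \<le> F"
proof -
  obtain p where p: "p \<noteq> bot" "p \<le> F" and min: "\<And>q. q \<noteq> bot \<Longrightarrow> q \<le> p \<Longrightarrow> q = p"
    using exists_minimal_filter[OF assms(1)] by metis
  have "eventually (\<lambda>x. x \<in> A) p \<or> eventually (\<lambda>x. x \<in> posnat - A) p" for A
  proof (cases "inf p (principal A) = bot")
    case True
    then have "eventually (\<lambda>x. x \<notin> A) p"
      by (simp add: trivial_limit_def eventually_inf_principal)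
    moreover have "eventually (\<lambda>x. x \<in> posnat) p"
      using p(2) assms(2) le_principal order_trans by blast
    ultimately have "eventually (\<lambda>x. x \<in> posnat - A) p" by eventually_elim simp
    then show ?thesis ..
  next
    case False
    then have "p \<le> principal A" by (metis min inf_le1 inf_le2)
    then show ?thesis by (simp add: le_principal)
  qed
  then have "p \<in> beta_N"
    using p assms(2) by (auto simp: beta_N_def ultrafilter_on_def)
  then show thesis using p(2) that by blast
qed

lemma beta_N_ne_bot: "p \<in> beta_N \<Longrightarrow> p \<noteq> bot"
  and beta_N_le_principal: "p \<in> beta_N \<Longrightarrow> p \<le> principal posnat"
  and beta_N_posnat: "p \<in> beta_N \<Longrightarrow> eventually (\<lambda>n. n \<in> posnat) p"
  by (auto simp: beta_N_def ultrafilter_on_def le_principal)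

lemma beta_N_dichotomy:
  assumes "p \<in> beta_N" "A \<subseteq> posnat"
  shows "eventually (\<lambda>n. n \<in> A) p \<or> eventually (\<lambda>n. n \<in> posnat - A) p"
  using assms by (simp only: beta_N_def ultrafilter_on_def mem_Collect_eq)

text \<open>The ultrafilter property for arbitrary predicates. As a rewrite rule it carries a
  negation through both quantifiers of \<open>eventually_usum\<close>.\<close>

lemma beta_N_eventually_not:
  assumes "p \<in> beta_N"
  shows "eventually (\<lambda>n. \<not> P n) p \<longleftrightarrow> \<not> eventually P p"
proof
  assume "eventually (\<lambda>n. \<not> P n) p"
  then show "\<not> eventually P p"
    using beta_N_ne_bot[OF assms] eventually_conj[of P p "\<lambda>n. \<not> P n"]
    by (auto simp: trivial_limit_def)
next
  assume "\<not> eventually P p"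
  then have "\<not> eventually (\<lambda>n. n \<in> {n \<in> posnat. P n}) p"
    using eventually_mono[of "\<lambda>n. n \<in> {n \<in> posnat. P n}" p P] by blast
  then have "eventually (\<lambda>n. n \<in> posnat - {n \<in> posnat. P n}) p"
    using beta_N_dichotomy[OF assms, of "{n \<in> posnat. P n}"] by blast
  then show "eventually (\<lambda>n. \<not> P n) p" by (auto elim: eventually_mono)
qed

text \<open>If \<open>P\<close> held for \<open>p\<close> but not for \<open>q\<close>, its negation
  would hold for \<open>q\<close>, hence for the smaller \<open>p\<close>.\<close>

lemma beta_N_le_imp_eq:
  assumes "p \<in> beta_N" "q \<in> beta_N" "p \<le> q"
  shows "p = q"
proof (rule filter_eqI)
  show "eventually P p \<longleftrightarrow> eventually P q" for P
    using assms beta_N_eventually_not[of p P] beta_N_eventually_not[of q P]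
    unfolding le_filter_def by blast
qed

lemma beta_NI:
  assumes "eventually (\<lambda>n. n \<in> posnat) p"
    and "\<And>P. eventually (\<lambda>n. \<not> P n) p \<longleftrightarrow> \<not> eventually P p"
  shows "p \<in> beta_N"
proof -
  have "p \<noteq> bot" using assms(2)[of "\<lambda>_. True"] by (auto simp: trivial_limit_def)
  moreover have "eventually (\<lambda>x. x \<in> A) p \<or> eventually (\<lambda>x. x \<in> posnat - A) p" for A
    using eventually_conj[OF assms(1), of "\<lambda>x. x \<notin> A"] assms(2)[of "\<lambda>n. n \<in> A"] by auto
  ultimately show ?thesis
    using assms(1) by (auto simp: beta_N_def ultrafilter_on_def le_principal)
qed

lemma beta_N_nonempty: "beta_N \<noteq> {}"
  using exists_beta_N[of "principal posnat"] by (auto simp: principal_eq_bot_iff)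

lemma usum_beta_N:
  assumes "q \<in> beta_N" "p \<in> beta_N"
  shows "q \<oplus> p \<in> beta_N"
proof (rule beta_NI)
  have "eventually (\<lambda>w. v + w \<in> posnat) p" for v
    using beta_N_posnat[OF assms(2)] by (auto elim: eventually_mono)
  then show "eventually (\<lambda>n. n \<in> posnat) (q \<oplus> p)"
    by (simp add: eventually_usum[OF assms])
  show "eventually (\<lambda>n. \<not> P n) (q \<oplus> p) \<longleftrightarrow> \<not> eventually P (q \<oplus> p)" for P
    by (simp add: eventually_usum[OF assms] beta_N_eventually_not assms)
qed

lemma usum_assoc:
  assumes "p \<in> beta_N" "q \<in> beta_N" "r \<in> beta_N"
  shows "p \<oplus> q \<oplus> r = p \<oplus> (q \<oplus> r)"
  by (rule filter_eqI) (simp add: eventually_usum usum_beta_N assms add.assoc)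

subsection \<open>Closed sets of ultrafilters\<close>

text \<open>\<open>Sup C\<close> consists of the sets common to all members of \<open>C\<close>, so
  the ultrafilters below it form the topological closure of \<open>C\<close>.\<close>

definition closed_beta :: "nat filter set \<Rightarrow> bool" where
  "closed_beta C \<longleftrightarrow> C \<subseteq> beta_N \<and> (\<forall>p\<in>beta_N. p \<le> Sup C \<longrightarrow> p \<in> C)"

lemma closed_beta_Inter:
  assumes "\<C> \<noteq> {}" "\<And>C. C \<in> \<C> \<Longrightarrow> closed_beta C"
  shows "closed_beta (\<Inter>\<C>)"
proof -
  have "p \<in> C" if "p \<in> beta_N" "p \<le> Sup (\<Inter>\<C>)" "C \<in> \<C>" for p C
  proof -
    have "Sup (\<Inter>\<C>) \<le> Sup C" by (rule Sup_subset_mono) (use that in blast)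
    then show ?thesis
      using that assms(2) order_trans unfolding closed_beta_def by blast
  qed
  moreover have "\<Inter>\<C> \<subseteq> beta_N" using assms unfolding closed_beta_def by blast
  ultimately show ?thesis by (auto simp: closed_beta_def)
qed

text \<open>Compactness for chains: the suprema form a chain of proper filters, their infimum is
  proper, and an ultrafilter below it lies in each \<open>C\<close> by closedness.\<close>

lemma closed_beta_chain_nonempty:
  assumes "\<C> \<noteq> {}" and cl: "\<And>C. C \<in> \<C> \<Longrightarrow> closed_beta C \<and> C \<noteq> {}"
    and chain: "\<And>C D. C \<in> \<C> \<Longrightarrow> D \<in> \<C> \<Longrightarrow> C \<subseteq> D \<or> D \<subseteq> C"
  shows "\<Inter>\<C> \<noteq> {}"
proof -
  have "Inf (Sup ` \<C>) \<noteq> bot"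
  proof (rule filter_Inf_chain_ne_bot)
    show "F \<le> G \<or> G \<le> F" if "F \<in> Sup ` \<C>" "G \<in> Sup ` \<C>" for F G
      using that chain by (metis Sup_subset_mono imageE)
    show "F \<noteq> bot" if F: "F \<in> Sup ` \<C>" for F
    proof -
      obtain C p where C: "C \<in> \<C>" "F = Sup C" "p \<in> C" using F cl by blast
      then have "p \<noteq> bot" using cl beta_N_ne_bot unfolding closed_beta_def by blast
      then show ?thesis using C Sup_upper[of p C] bot.extremum_uniqueI by metis
    qed
  qed (use assms in auto)
  moreover have "Inf (Sup ` \<C>) \<le> principal posnat"
  proof -
    obtain C where C: "C \<in> \<C>" using assms(1) by blast
    have "Sup C \<le> principal posnat"
      by (rule Sup_least)
        (use cl[OF C] in \<open>auto simp only: closed_beta_def beta_N_le_principal subset_iff\<close>)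
    then show ?thesis using C by (meson INF_lower2)
  qed
  ultimately obtain p where p: "p \<in> beta_N" "p \<le> Inf (Sup ` \<C>)"
    using exists_beta_N by blast
  have "p \<in> C" if "C \<in> \<C>" for C
    using that p cl INF_lower[OF that, of Sup] order_trans unfolding closed_beta_def by blast
  then show ?thesis by blast
qed

text \<open>\<open>Q\<close> is left open because this is applied twice: to closed subsemigroups and
  to closed left ideals.\<close>

lemma exists_minimal_closed_beta:
  assumes "closed_beta C" "C \<noteq> {}" "Q C"
    and Q: "\<And>\<C>. \<C> \<noteq> {} \<Longrightarrow> (\<And>C. C \<in> \<C> \<Longrightarrow> Q C) \<Longrightarrow> Q (\<Inter>\<C>)"
  obtains M where "M \<subseteq> C" "closed_beta M" "M \<noteq> {}" "Q M"
    "\<And>N. N \<subseteq> M \<Longrightarrow> closed_beta N \<Longrightarrow> N \<noteq> {} \<Longrightarrow> Q N \<Longrightarrow> N = M"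
proof -
  define S where "S = {N. N \<subseteq> C \<and> closed_beta N \<and> N \<noteq> {} \<and> Q N}"
  have "\<exists>m\<in>S. \<forall>a\<in>S. a \<subseteq> m \<longrightarrow> a = m"
  proof (rule predicate_Zorn[where P = "\<lambda>a b. b \<subseteq> a" and A = S])
    show "partial_order_on S (relation_of (\<lambda>a b. b \<subseteq> a) S)"
      by (rule partial_order_on_relation_ofI) auto
  next
    fix \<C> assume C: "\<C> \<in> Chains (relation_of (\<lambda>a b. b \<subseteq> a) S)"
    have CS: "\<C> \<subseteq> S" and ch: "\<And>a b. a \<in> \<C> \<Longrightarrow> b \<in> \<C> \<Longrightarrow> a \<subseteq> b \<or> b \<subseteq> a"
      using C by (auto simp: Chains_def relation_of_def)
    show "\<exists>u\<in>S. \<forall>a\<in>\<C>. u \<subseteq> a"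
    proof (cases "\<C> = {}")
      case True
      then show ?thesis using assms S_def by auto
    next
      case False
      have *: "closed_beta D \<and> D \<noteq> {}" "Q D" "D \<subseteq> C" if "D \<in> \<C>" for D
        using that CS by (auto simp: S_def)
      have "\<Inter>\<C> \<noteq> {}" by (rule closed_beta_chain_nonempty[OF False *(1) ch])
      moreover have "\<Inter>\<C> \<subseteq> C" using False *(3) by blast
      ultimately have "\<Inter>\<C> \<in> S"
        using closed_beta_Inter[OF False] Q[OF False] * by (auto simp: S_def)
      then show ?thesis by blast
    qed
  qed
  then obtain M where "M \<in> S" "\<forall>a\<in>S. a \<subseteq> M \<longrightarrow> a = M" by blast
  then show thesis by (intro that[of M]) (auto simp: S_def)
qed

lemma closed_beta_beta_N: "closed_beta beta_N"
  by (simp add: closed_beta_def)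

lemma closed_beta_singleton: "p \<in> beta_N \<Longrightarrow> closed_beta {p}"
  by (auto simp: closed_beta_def beta_N_le_imp_eq)

text \<open>Continuity of \<open>\<lambda>y. y \<oplus> x\<close>: that \<open>P\<close> holds for
  \<open>y \<oplus> x\<close> is a condition on \<open>y\<close> through one fixed predicate, so it
  passes to the supremum.\<close>

lemma closed_beta_vimage_usum:
  assumes "closed_beta T" "closed_beta C" "x \<in> beta_N"
  shows "closed_beta {y \<in> T. y \<oplus> x \<in> C}"
proof -
  let ?D = "{y \<in> T. y \<oplus> x \<in> C}"
  have T: "T \<subseteq> beta_N" using assms(1) by (simp add: closed_beta_def)
  have "q \<in> ?D" if q: "q \<in> beta_N" "q \<le> Sup ?D" for q
  proof -
    have "Sup ?D \<le> Sup T" by (rule Sup_subset_mono) blast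
    then have "q \<in> T" using q assms(1) order_trans unfolding closed_beta_def by blast
    moreover have "q \<oplus> x \<le> Sup C"
    proof (rule filter_leI)
      fix P assume "eventually P (Sup C)"
      then have "\<forall>y\<in>?D. eventually (\<lambda>v. eventually (\<lambda>w. P (v + w)) x) y"
        using T assms(3) by (auto simp: eventually_Sup simp flip: eventually_usum)
      then have "eventually (\<lambda>v. eventually (\<lambda>w. P (v + w)) x) (Sup ?D)"
        by (simp add: eventually_Sup)
      then show "eventually P (q \<oplus> x)"
        using q(2) by (simp add: eventually_usum q(1) assms(3) le_filter_def)
    qed
    ultimately show ?thesis
      using assms(2) usum_beta_N[OF q(1) assms(3)] unfolding closed_beta_def by blast
  qed
  then show ?thesis using T unfolding closed_beta_def by blast
qed

text \<open>A continuous image of a compact set is closed. For \<open>r\<close> in the closure of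
  the image, the sets of \<open>r\<close> are pulled back and traced on \<open>C\<close>; an
  ultrafilter below the resulting filter is a preimage of \<open>r\<close>.\<close>

lemma closed_beta_image_usum:
  assumes C: "closed_beta C" "C \<noteq> {}" and x: "x \<in> beta_N"
  shows "closed_beta ((\<lambda>q. q \<oplus> x) ` C)"
proof -
  have CN: "C \<subseteq> beta_N" using C(1) by (simp add: closed_beta_def)
  have "r \<in> (\<lambda>q. q \<oplus> x) ` C"
    if r: "r \<in> beta_N" "r \<le> Sup ((\<lambda>q. q \<oplus> x) ` C)" for r
  proof -
    \<comment> \<open>The pullback of \<open>P\<close>: for \<open>y\<close> in
      \<open>beta_N\<close>, \<open>P\<close> holds for \<open>y \<oplus> x\<close> exactly if
      \<open>B P\<close> belongs to \<open>y\<close>.\<close>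
    define B where "B P = {v. eventually (\<lambda>w. P (v + w)) x}" for P
    define \<F> where "\<F> = (\<lambda>P. inf (Sup C) (principal (B P))) ` {P. eventually P r}"
    have "\<exists>F\<in>\<F>. F \<le> inf G H" if GH: "G \<in> \<F>" "H \<in> \<F>" for G H
    proof -
      obtain P Q where PQ: "eventually P r" "eventually Q r"
        "G = inf (Sup C) (principal (B P))" "H = inf (Sup C) (principal (B Q))"
        using GH unfolding \<F>_def by blast
      have "B (\<lambda>n. P n \<and> Q n) = B P \<inter> B Q"
        by (auto simp: B_def eventually_conj_iff)
      then have "inf (Sup C) (principal (B (\<lambda>n. P n \<and> Q n))) \<le> inf G H"
        unfolding PQ by (simp add: le_infI2 flip: inf_principal)
      moreover have "eventually (\<lambda>n. P n \<and> Q n) r" using PQ(1,2) by (rule eventually_conj)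
      ultimately show ?thesis unfolding \<F>_def by blast
    qed
    moreover have "\<F> \<noteq> {}" unfolding \<F>_def using eventually_True by blast
    \<comment> \<open>Otherwise every \<open>y\<close> in \<open>C\<close> would avoid
      \<open>B P\<close>, so the negation of \<open>P\<close> would hold on the whole image and
      hence for \<open>r\<close>.\<close>
    moreover have "F \<noteq> bot" if F: "F \<in> \<F>" for F
    proof
      assume "F = bot"
      then obtain P where P: "eventually P r" "eventually (\<lambda>v. v \<notin> B P) (Sup C)"
        using F by (auto simp: \<F>_def trivial_limit_def eventually_inf_principal)
      have "eventually (\<lambda>n. \<not> P n) (y \<oplus> x)" if "y \<in> C" for y
      proof -
        have "eventually (\<lambda>v. v \<notin> B P) y" using P(2) that by (simp add: eventually_Sup)
        moreover have "y \<in> beta_N" using CN that by blast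
        ultimately show ?thesis
          by (simp add: B_def eventually_usum x beta_N_eventually_not)
      qed
      then have "eventually (\<lambda>n. \<not> P n) (Sup ((\<lambda>q. q \<oplus> x) ` C))"
        by (simp add: eventually_Sup)
      then have "eventually (\<lambda>n. \<not> P n) r" using r(2) by (simp add: le_filter_def)
      then show False using P(1) beta_N_eventually_not[OF r(1)] by blast
    qed
    ultimately have ne: "Inf \<F> \<noteq> bot"
      using eventually_Inf_base[of \<F> "\<lambda>_. False"] by (auto simp: trivial_limit_def)
    have le: "Inf \<F> \<le> inf (Sup C) (principal (B P))" if "eventually P r" for P
      unfolding \<F>_def by (rule INF_lower) (use that in simp)
    have leC: "Inf \<F> \<le> Sup C" using le[OF eventually_True] by simp
    have "Sup C \<le> principal posnat"
      by (rule Sup_least) (use CN in \<open>auto simp only: beta_N_le_principal subset_iff\<close>)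
    then obtain q where q: "q \<in> beta_N" "q \<le> Inf \<F>"
      using exists_beta_N[OF ne order_trans[OF leC]] by blast
    then have "q \<in> C" using leC C(1) order_trans unfolding closed_beta_def by blast
    moreover have "q \<oplus> x \<le> r"
    proof (rule filter_leI)
      fix P assume "eventually P r"
      then have "q \<le> principal (B P)" using le q(2) by (meson le_inf_iff order_trans)
      then show "eventually P (q \<oplus> x)"
        by (simp add: le_principal B_def eventually_usum q x)
    qed
    then have "q \<oplus> x = r" using beta_N_le_imp_eq usum_beta_N q(1) x r(1) by blast
    ultimately show ?thesis by blast
  qed
  then show ?thesis using CN usum_beta_N x unfolding closed_beta_def by blast
qed

subsection \<open>Minimal idempotents\<close>

text \<open>Ellis: let \<open>M\<close> be a minimal closed subsemigroup and \<open>x\<close> in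
  \<open>M\<close>. The closed subsemigroup \<open>M \<oplus> x\<close> must be \<open>M\<close>, so
  \<open>y \<oplus> x = x\<close> has a solution in \<open>M\<close>. The solutions again form a
  closed subsemigroup, so they fill \<open>M\<close> and include \<open>x\<close> itself.\<close>

lemma exists_idempotent:
  assumes "closed_beta T" "T \<noteq> {}" "\<And>x y. x \<in> T \<Longrightarrow> y \<in> T \<Longrightarrow> x \<oplus> y \<in> T"
  obtains e where "e \<in> T" "idempotent e"
proof -
  define Q where "Q M \<longleftrightarrow> (\<forall>x\<in>M. \<forall>y\<in>M. x \<oplus> y \<in> M)" for M
  have "Q T" using assms(3) by (simp add: Q_def)
  moreover have "Q (\<Inter>\<C>)" if "\<And>C. C \<in> \<C> \<Longrightarrow> Q C" for \<C>
    using that unfolding Q_def by blast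
  ultimately obtain M where M: "M \<subseteq> T" "closed_beta M" "M \<noteq> {}" "Q M"
    and min: "\<And>N. N \<subseteq> M \<Longrightarrow> closed_beta N \<Longrightarrow> N \<noteq> {} \<Longrightarrow> Q N \<Longrightarrow> N = M"
    using exists_minimal_closed_beta[OF assms(1,2), of Q] by metis
  obtain x where x: "x \<in> M" using M(3) by blast
  have MN: "M \<subseteq> beta_N" using M(2) by (simp add: closed_beta_def)
  then have xN: "x \<in> beta_N" using x by blast
  have assoc: "a \<oplus> b \<oplus> c = a \<oplus> (b \<oplus> c)" if "a \<in> M" "b \<in> M" "c \<in> M" for a b c
    using usum_assoc that MN by blast
  have cl: "a \<oplus> b \<in> M" if "a \<in> M" "b \<in> M" for a b using M(4) that by (simp add: Q_def)
  have "(\<lambda>q. q \<oplus> x) ` M = M"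
  proof (rule min)
    show "closed_beta ((\<lambda>q. q \<oplus> x) ` M)" by (rule closed_beta_image_usum[OF M(2,3) xN])
    have "a \<oplus> x \<oplus> (b \<oplus> x) = (a \<oplus> x \<oplus> b) \<oplus> x" if "a \<in> M" "b \<in> M" for a b
      using assoc cl x that by metis
    then show "Q ((\<lambda>q. q \<oplus> x) ` M)" using cl x by (auto simp: Q_def)
  qed (use M x cl in auto)
  then have "x \<in> (\<lambda>q. q \<oplus> x) ` M" using x by simp
  then have ne: "{y \<in> M. y \<oplus> x \<in> {x}} \<noteq> {}" by auto
  have "{y \<in> M. y \<oplus> x \<in> {x}} = M"
  proof (rule min)
    show "closed_beta {y \<in> M. y \<oplus> x \<in> {x}}"
      by (rule closed_beta_vimage_usum[OF M(2) closed_beta_singleton[OF xN] xN])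
    show "Q {y \<in> M. y \<oplus> x \<in> {x}}" using cl assoc x by (auto simp: Q_def)
  qed (use ne in auto)
  then have "x \<oplus> x = x" using x by blast
  then show thesis using that x M(1) xN by (auto simp: idempotent_def)
qed

text \<open>An idempotent \<open>e'\<close> below \<open>e\<close> lies in the same minimal left
  ideal \<open>L\<close>, since \<open>e' = e' \<oplus> e\<close>. By minimality it generates
  \<open>L\<close>, so \<open>e = q \<oplus> e'\<close>; then \<open>e'\<close> is a right identity
  for \<open>e\<close>, and \<open>e = e \<oplus> e' = e'\<close>.\<close>

lemma exists_minimal_idempotent:
  assumes p: "p \<in> beta_N"
  obtains e where "e \<in> beta_N_plus p" "minimal_idempotent e"
proof -
  define Q where "Q M \<longleftrightarrow> (\<forall>q\<in>beta_N. \<forall>y\<in>M. q \<oplus> y \<in> M)" for M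
  have eq: "beta_N_plus x = (\<lambda>q. q \<oplus> x) ` beta_N" for x by (auto simp: beta_N_plus_def)
  have cl: "closed_beta (beta_N_plus x)" if "x \<in> beta_N" for x
    unfolding eq by (rule closed_beta_image_usum[OF closed_beta_beta_N beta_N_nonempty that])
  have ne: "beta_N_plus x \<noteq> {}" for x using beta_N_nonempty by (simp add: eq)
  have left: "Q (beta_N_plus x)" if "x \<in> beta_N" for x
    using that by (auto simp: Q_def eq usum_beta_N simp flip: usum_assoc)
  have Q: "Q (\<Inter>\<C>)" if "\<And>C. C \<in> \<C> \<Longrightarrow> Q C" for \<C>
    using that unfolding Q_def by blast
  obtain L where L: "L \<subseteq> beta_N_plus p" "closed_beta L" "L \<noteq> {}" "Q L"
    and min: "\<And>N. N \<subseteq> L \<Longrightarrow> closed_beta N \<Longrightarrow> N \<noteq> {} \<Longrightarrow> Q N \<Longrightarrow> N = L"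
    using exists_minimal_closed_beta[OF cl[OF p] ne left[OF p] Q] by metis
  have LN: "L \<subseteq> beta_N" using L(2) by (simp add: closed_beta_def)
  have "x \<oplus> y \<in> L" if "x \<in> L" "y \<in> L" for x y using L(4) LN that by (auto simp: Q_def)
  then obtain e where e: "e \<in> L" "idempotent e" using exists_idempotent[OF L(2,3)] by metis
  have "e' = e" if e': "idempotent e'" "idem_le e' e" for e'
  proof -
    have N: "e' \<in> beta_N" and ee: "e' \<oplus> e' = e'" using e' by (simp_all add: idempotent_def)
    have le: "e' \<oplus> e = e'" "e \<oplus> e' = e'" using e' by (simp_all add: idem_le_def)
    have "e' \<in> L" using L(4) N e(1) le(1) unfolding Q_def by metis
    then have "beta_N_plus e' \<subseteq> L" using L(4) by (auto simp: Q_def eq)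
    then have "beta_N_plus e' = L" by (rule min[OF _ cl[OF N] ne left[OF N]])
    then obtain q where q: "q \<in> beta_N" "e = q \<oplus> e'" using e(1) by (auto simp: eq)
    then have "e \<oplus> e' = e" by (simp add: usum_assoc N ee)
    then show ?thesis using le(2) by simp
  qed
  then show thesis using that e L(1) by (auto simp: minimal_idempotent_def)
qed

subsection \<open>Rapid ultrafilters\<close>

lemma rapidE:
  assumes "rapid p" "f \<in> posnat \<rightarrow> posnat"
  obtains A where "A \<in> members p" "\<forall>i\<in>posnat. card {a \<in> A. a < f i} < i"
  using assms unfolding rapid_def by blast

text \<open>Rapid ultrafilters are nonprincipal; this allows the lower bound on \<open>w\<close> in
  the proof for sums.\<close>

lemma rapid_eventually_ge:
  assumes "rapid p"
  shows "eventually (\<lambda>n. m \<le> n) p"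
proof -
  \<comment> \<open>At \<open>i = 1\<close> the rapidity bound leaves no element of \<open>A\<close>
    below \<open>Suc m\<close>.\<close>
  have "(\<lambda>_. Suc m) \<in> posnat \<rightarrow> posnat" by auto
  from rapidE[OF assms this] obtain A
    where A: "A \<in> members p" "\<forall>i\<in>posnat. card {a \<in> A. a < Suc m} < i" .
  have "card {a \<in> A. a < Suc m} < 1" using A(2) by (rule bspec) simp
  moreover have "finite {a \<in> A. a < Suc m}" by (rule finite_subset[of _ "{..m}"]) auto
  ultimately have "{a \<in> A. a < Suc m} = {}" by (metis card_0_eq less_one)
  moreover have "eventually (\<lambda>n. n \<in> A) p" using A(1) by (simp add: members_def)
  ultimately show ?thesis by (auto elim!: eventually_mono)
qed

lemma rapid_usum:
  assumes q: "q \<in> beta_N" and p: "rapid p"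
  shows "rapid (q \<oplus> p)"
proof -
  have pN: "p \<in> beta_N" using p by (simp add: rapid_def)
  have "\<exists>A\<in>members (q \<oplus> p). \<forall>i\<in>posnat. card {a \<in> A. a < f i} < i"
    if f: "f \<in> posnat \<rightarrow> posnat" for f
  proof -
    \<comment> \<open>Partial sums give monotonicity; the added 1 keeps \<open>g\<close> positive
      even at 0.\<close>
    define g where "g i = (\<Sum>j=1..i. f j) + 1" for i
    have mono: "g i \<le> g j" if "i \<le> j" for i j
      unfolding g_def using that by (intro add_right_mono sum_mono2) auto
    have fg: "f i \<le> g i" if "i \<in> posnat" for i
      unfolding g_def using that member_le_sum[of i "{1..i}" f] by simp
    have "(\<lambda>j. g (j * j)) \<in> posnat \<rightarrow> posnat" by (auto simp: g_def)
    from rapidE[OF p this] obtain A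
      where A: "A \<in> members p" "\<forall>j\<in>posnat. card {a \<in> A. a < g (j * j)} < j" .
    define S where "S = {v + w | v w. v \<in> posnat \<and> w \<in> A \<and> g (v * v) \<le> w}"
    have "eventually (\<lambda>w. v + w \<in> S) p" if "v \<in> posnat" for v
    proof -
      have "eventually (\<lambda>w. w \<in> A) p" using A(1) by (simp add: members_def)
      with rapid_eventually_ge[OF p, of "g (v * v)"] show ?thesis
        by eventually_elim (use that in \<open>auto simp: S_def\<close>)
    qed
    then have "eventually (\<lambda>n. n \<in> S) (q \<oplus> p)"
      unfolding eventually_usum[OF q pN] using beta_N_posnat[OF q] by (auto elim: eventually_mono)
    then have "S \<in> members (q \<oplus> p)" by (auto simp: members_def S_def)
    moreover have "card {a \<in> S. a < f i} < i" if i: "i \<in> posnat" for i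
    proof -
      define m where "m = (LEAST m. i \<le> m * m)"
      have im: "i \<le> m * m" unfolding m_def by (rule LeastI[of _ i]) simp
      then have m: "1 \<le> m" using i by (cases m) auto
      \<comment> \<open>Since \<open>m\<close> is at least 1, \<open>m - 1\<close> is a true
        predecessor and fails the defining condition of \<open>m\<close>.\<close>
      have least: "(m - 1) * (m - 1) < i"
        using not_less_Least[of "m - 1" "\<lambda>m. i \<le> m * m"] m unfolding m_def[symmetric] by simp
      define W where "W = {a \<in> A. a < g (m * m)}"
      have finW: "finite W" unfolding W_def by (rule finite_subset[of _ "{..<g (m * m)}"]) auto
      have "{a \<in> S. a < f i} \<subseteq> (\<lambda>(v, w). v + w) ` ({1..m - 1} \<times> W)"
      proof
        fix a assume "a \<in> {a \<in> S. a < f i}"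
        then obtain v w where a: "a = v + w" "a < f i" and v: "v \<in> posnat"
          and w: "w \<in> A" "g (v * v) \<le> w" by (auto simp: S_def)
        have wg: "w < g i" using a fg[OF i] by simp
        \<comment> \<open>If \<open>i \<le> v * v\<close>, then
          \<open>g i \<le> g (v * v) \<le> w\<close>, against \<open>w < g i\<close>.\<close>
        then have "v * v < i" using w(2) mono[of i "v * v"] by linarith
        then have "v * v < m * m" using im by simp
        then have "v < m" by (meson mult_le_mono not_le)
        moreover have "w < g (m * m)" using wg mono[OF im] by simp
        ultimately show "a \<in> (\<lambda>(v, w). v + w) ` ({1..m - 1} \<times> W)"
          using v w(1) a(1) by (auto simp: W_def intro!: image_eqI[of _ _ "(v, w)"])
      qed
      then have "card {a \<in> S. a < f i} \<le> card ({1..m - 1} \<times> W)"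
        using finW by (meson card_image_le card_mono finite_SigmaI finite_atLeastAtMost
            finite_imageI order_trans)
      also have "\<dots> = (m - 1) * card W" by (simp add: card_cartesian_product)
      \<comment> \<open>The choice of \<open>A\<close> at index \<open>m\<close> gives
        \<open>card W < m\<close>.\<close>
      also have "\<dots> \<le> (m - 1) * (m - 1)"
        using A(2) m by (intro mult_le_mono2) (auto simp: W_def dest!: bspec[of _ _ m])
      finally show ?thesis using least by simp
    qed
    ultimately show ?thesis by blast
  qed
  then show ?thesis using usum_beta_N[OF q pN] by (simp add: rapid_def)
qed

theorem theorem4:
  shows "((\<exists>p. rapid p) \<longrightarrow> (\<exists>e. idempotent e \<and> rapid e)) \<and>
    (\<forall>p. rapid p \<longrightarrow>
      (\<forall>r \<in> beta_N_plus p. rapid r) \<and>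
      (\<exists>e \<in> beta_N_plus p. minimal_idempotent e \<and> rapid e))"
proof -
  have rap: "rapid r" if "rapid p" "r \<in> beta_N_plus p" for p r
    using that rapid_usum by (auto simp: beta_N_plus_def)
  have "\<exists>e\<in>beta_N_plus p. minimal_idempotent e \<and> rapid e" if "rapid p" for p
    using exists_minimal_idempotent[of p] rap[OF that] that by (metis rapid_def)
  then show ?thesis using rap by (metis minimal_idempotent_def)
qed

end
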